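(* Every 2-page book drawing of a graph is separable.
   Context: A 2-page book drawing of a graph is a drawing in the plane in which all vertices are distinct points on a common straight line and each edge is drawn as a half-circle between its two end-vertices, lying on one of the two sides of the line (with the segment between its end-vertices as diameter). A simple drawing of a graph is a representation in the plane (or on the sphere) in which vertices are mapped to distinct points and edges to Jordan arcs connecting their respective end-vertices (an edge passes through no vertex other than its end-vertices), such that every pair of edges has at most one point in common, which is either a common end-vertex or a proper crossing. An edge $e$ of a simple drawing $\mathcal{D}$ is a separator edge if there is a simple closed curve $\gamma_e$ containing $e$ such that the only vertices of $\mathcal{D}$ on $\gamma_e$ are the end-vertices of $e$ and such that $\gamma_e$ has at most one point in common with each edge $f\neq e$ of $\mathcal{D}$ (this point being a proper crossing or an end-vertex of $f$). A simple drawing is separable if every one of its edges is a separator edge. *)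

theory Defs
  imports "HOL-Analysis.Analysis"
begin

definition simple_graph :: "'a set \<Rightarrow> 'a set set \<Rightarrow> bool" where
  "simple_graph V E \<longleftrightarrow> (\<forall>e\<in>E. e \<subseteq> V \<and> card e = 2)"

text \<open>A drawing of a graph consists of a placement \<open>pos\<close> of the vertices in the plane (the
  type \<^typ>\<open>complex\<close>) and of a point set \<open>crv e\<close> for every edge \<open>e\<close>.\<close>

text \<open>Two curves, given as point sets, cross properly at \<open>p\<close> if some open neighbourhood of \<open>p\<close> can be
  mapped homeomorphically onto the unit disc so that \<open>p\<close> goes to the centre and the two curves
  become the horizontal and the vertical diameter. This rules out touchings as well as points
  \<open>p\<close> at which one of the curves ends.\<close>

definition proper_crossing :: "complex \<Rightarrow> complex set \<Rightarrow> complex set \<Rightarrow> bool" where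
  "proper_crossing p A B \<longleftrightarrow>
    (\<exists>U h k. open U \<and> p \<in> U \<and> homeomorphism U (ball (0::complex) 1) h k \<and> h p = 0 \<and>
       h ` (A \<inter> U) = {z \<in> ball 0 1. Im z = 0} \<and>
       h ` (B \<inter> U) = {z \<in> ball 0 1. Re z = 0})"

definition simple_drawing ::
  "'a set \<Rightarrow> 'a set set \<Rightarrow> ('a \<Rightarrow> complex) \<Rightarrow> ('a set \<Rightarrow> complex set) \<Rightarrow> bool" where
  "simple_drawing V E pos crv \<longleftrightarrow>
    simple_graph V E \<and> inj_on pos V \<and>
    (\<forall>e\<in>E. \<exists>g. arc g \<and> path_image g = crv e \<and> {pathstart g, pathfinish g} = pos ` e) \<and>
    (\<forall>e\<in>E. crv e \<inter> pos ` V = pos ` e) \<and>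
    (\<forall>e\<in>E. \<forall>f\<in>E. e \<noteq> f \<longrightarrow>
       (\<forall>p \<in> crv e \<inter> crv f. \<forall>q \<in> crv e \<inter> crv f. p = q) \<and>
       (\<forall>p \<in> crv e \<inter> crv f. p \<in> pos ` (e \<inter> f) \<or> proper_crossing p (crv e) (crv f)))"

definition separator_edge ::
  "'a set \<Rightarrow> 'a set set \<Rightarrow> ('a \<Rightarrow> complex) \<Rightarrow> ('a set \<Rightarrow> complex set) \<Rightarrow> 'a set \<Rightarrow> bool" where
  "separator_edge V E pos crv e \<longleftrightarrow>
    (\<exists>\<gamma>. simple_path \<gamma> \<and> pathfinish \<gamma> = pathstart \<gamma> \<and>
       crv e \<subseteq> path_image \<gamma> \<and> path_image \<gamma> \<inter> pos ` V = pos ` e \<and>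
       (\<forall>f\<in>E. f \<noteq> e \<longrightarrow>
          (\<forall>p \<in> path_image \<gamma> \<inter> crv f. \<forall>q \<in> path_image \<gamma> \<inter> crv f. p = q) \<and>
          (\<forall>p \<in> path_image \<gamma> \<inter> crv f.
             proper_crossing p (path_image \<gamma>) (crv f) \<or> p \<in> pos ` f)))"

definition separable_drawing ::
  "'a set \<Rightarrow> 'a set set \<Rightarrow> ('a \<Rightarrow> complex) \<Rightarrow> ('a set \<Rightarrow> complex set) \<Rightarrow> bool" where
  "separable_drawing V E pos crv \<longleftrightarrow>
    simple_drawing V E pos crv \<and> (\<forall>e\<in>E. separator_edge V E pos crv e)"

text \<open>For \<open>x\<close> and \<open>y\<close> on the line \<open>{z. n \<bullet> z = c}\<close>, the half-circle with diameter \<open>xy\<close> on the side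
  into which the normal \<open>n\<close> points. The half-circle on the other side of the same line is
  \<open>half_circle (-n) (-c) x y\<close>.\<close>

definition half_circle :: "complex \<Rightarrow> real \<Rightarrow> complex \<Rightarrow> complex \<Rightarrow> complex set" where
  "half_circle n c x y = {z \<in> sphere (midpoint x y) (dist x y / 2). n \<bullet> z \<ge> c}"

definition two_page_book_drawing ::
  "'a set \<Rightarrow> 'a set set \<Rightarrow> ('a \<Rightarrow> complex) \<Rightarrow> ('a set \<Rightarrow> complex set) \<Rightarrow> bool" where
  "two_page_book_drawing V E pos crv \<longleftrightarrow>
    simple_graph V E \<and> inj_on pos V \<and>
    (\<exists>n c. n \<noteq> 0 \<and> (\<forall>v\<in>V. n \<bullet> pos v = c) \<and>
       (\<forall>u v. {u, v} \<in> E \<longrightarrow>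
          crv {u, v} = half_circle n c (pos u) (pos v) \<or>
          crv {u, v} = half_circle (- n) (- c) (pos u) (pos v)))"

end

(* The full circle with the edge e as half serves as the closed curve through e. All these circles
   have their centres on the spine, so two different ones meet in points that are mirror images of
   each other; hence a circle meets a half-circle at most once, transversally off the spine. On the
   spine a circle only contains the end-points of its edge. *)

theory Submission
  imports Defs "HOL-Complex_Analysis.Contour_Integration" "HOL-Homology.Invariance_of_Domain"
begin

section \<open>Circles centred on a common line\<close>

text \<open>In the plane, two vectors orthogonal to a nonzero \<open>k\<close> are parallel, so the
  determinant of \<open>d\<close> and \<open>e\<close> vanishes. By the Binet-Cauchy identity it is
  a factor of the difference of the two sides.\<close>

lemma inner_parallel:
  fixes k d e f :: complex
  assumes "k \<noteq> 0" "k \<bullet> d = 0" "k \<bullet> e = 0"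
  shows "(d \<bullet> d) * (e \<bullet> f) = (d \<bullet> e) * (d \<bullet> f)"
proof -
  define D where "D = Re d * Im e - Im d * Re e"
  have "Re k * D = Im e * (k \<bullet> d) - Im d * (k \<bullet> e)" "Im k * D = Re d * (k \<bullet> e) - Re e * (k \<bullet> d)"
    by (simp_all add: D_def inner_complex_def algebra_simps)
  then have "D = 0" using assms by (auto simp: complex_eq_iff)
  moreover have "(d \<bullet> d) * (e \<bullet> f) - (d \<bullet> e) * (d \<bullet> f) = D * (Re d * Im f - Im d * Re f)"
    by (simp add: D_def inner_complex_def algebra_simps)
  ultimately show ?thesis by simp
qed

text \<open>Equal distances to \<open>a\<close> and \<open>b\<close> make \<open>z - w\<close>
  orthogonal to \<open>b - a\<close>, hence parallel to \<open>n\<close>. So \<open>z\<close> and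
  \<open>w\<close> are equal or mirror images in the line, and two mirror images in the same closed
  half-plane coincide.\<close>

lemma equidistant_half_plane_unique:
  fixes n a b z w :: complex
  assumes n: "n \<noteq> 0" and ab: "a \<noteq> b" and a: "n \<bullet> a = c" and b: "n \<bullet> b = c"
    and z: "n \<bullet> z \<ge> c" and w: "n \<bullet> w \<ge> c"
    and da: "dist z a = dist w a" and db: "dist z b = dist w b"
  shows "z = w"
proof -
  define e where "e = z - w"
  have sa: "(z - a) \<bullet> (z - a) = (w - a) \<bullet> (w - a)"
    using da by (simp add: dist_norm norm_eq)
  have sb: "(z - b) \<bullet> (z - b) = (w - b) \<bullet> (w - b)"
    using db by (simp add: dist_norm norm_eq)
  \<comment> \<open>Difference of two squares. In \<open>eb\<close> the quadratic terms for
    \<open>a\<close> and \<open>b\<close> cancel.\<close>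
  have ea: "e \<bullet> (z + w - 2 *\<^sub>R a) = 0"
    using sa by (simp add: e_def algebra_simps inner_commute)
  have eb: "e \<bullet> (b - a) = 0"
    using sa sb by (simp add: e_def algebra_simps inner_commute)
  have nab: "n \<bullet> (b - a) = 0"
    using a b by (simp add: inner_diff_right)
  \<comment> \<open>Here \<open>b - a\<close> takes the role of the nonzero normal, and
    \<open>n\<close> and \<open>e\<close> are the two parallel vectors.\<close>
  have "b - a \<noteq> 0" "(b - a) \<bullet> n = 0" "(b - a) \<bullet> e = 0"
    using ab nab eb by (simp_all add: inner_commute)
  note parallel = inner_parallel[OF this]
  have "(n \<bullet> e) * (n \<bullet> (z + w - 2 *\<^sub>R a)) = 0"
    using parallel[of "z + w - 2 *\<^sub>R a"] ea by simp
  then consider "n \<bullet> e = 0" | "n \<bullet> z + n \<bullet> w = 2 * c"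
    using a by (auto simp: inner_simps)
  then have "n \<bullet> e = 0"
  proof cases
    \<comment> \<open>Both summands are at least \<open>c\<close>, so both equal
      \<open>c\<close>.\<close>
    case 2
    then show ?thesis using z w by (simp add: e_def inner_diff_right)
  qed
  then show ?thesis using parallel[of e] n by (simp add: e_def)
qed

text \<open>The powers with respect to the two circles serve as local coordinates: they are jointly
  injective on the open half-plane, so invariance of domain turns them into a chart.\<close>

lemma proper_crossing_circles:
  fixes n a b p :: complex
  assumes n: "n \<noteq> 0" and ab: "a \<noteq> b" and a: "n \<bullet> a = c" and b: "n \<bullet> b = c"
    and p: "n \<bullet> p > c" and pA: "p \<in> sphere a r" and pB: "p \<in> sphere b s"
    and A: "\<And>z. n \<bullet> z > c \<Longrightarrow> z \<in> A \<longleftrightarrow> z \<in> sphere a r"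
    and B: "\<And>z. n \<bullet> z > c \<Longrightarrow> z \<in> B \<longleftrightarrow> z \<in> sphere b s"
  shows "proper_crossing p A B"
proof -
  define H where "H = {z. n \<bullet> z > c}"
  \<comment> \<open>The power with respect to the circle of \<open>A\<close> is the imaginary part,
    so that \<open>A\<close> becomes the horizontal and \<open>B\<close> the vertical
    diameter.\<close>
  define F where "F = (\<lambda>z. Complex ((dist b z)\<^sup>2 - s\<^sup>2) ((dist a z)\<^sup>2 - r\<^sup>2))"
  \<comment> \<open>Nonnegative radii allow passing from equal squares back to equal
    distances.\<close>
  have rs: "r \<ge> 0" "s \<ge> 0" using pA pB by auto
  have H: "open H" unfolding H_def by (rule open_halfspace_gt)
  have contF: "continuous_on S F" for S
    unfolding F_def by (intro continuous_intros)
  have injF: "inj_on F H"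
  proof (rule inj_onI)
    fix z w assume zw: "z \<in> H" "w \<in> H" "F z = F w"
    then have "dist z a = dist w a" "dist z b = dist w b"
      by (simp_all add: F_def dist_commute)
    then show "z = w"
      using equidistant_half_plane_unique[OF n ab a b] zw(1,2) by (simp add: H_def)
  qed
  obtain G where G: "homeomorphism H (F ` H) F G"
    using invariance_of_domain_homeomorphism[OF H contF _ injF] by auto
  have openFH: "open (F ` H)"
    using invariance_of_domain[OF contF H injF] .
  have F0: "F p = 0" using pA pB by (simp add: F_def complex_eq_iff)
  have "0 \<in> F ` H" using F0 p by (metis H_def image_eqI mem_Collect_eq)
  \<comment> \<open>The preimage in \<open>H\<close> of this disc, with \<open>F\<close> rescaled by
    \<open>1 / d\<close>, is the chart onto the unit disc.\<close>
  then obtain d where d: "d > 0" "ball 0 d \<subseteq> F ` H"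
    using openFH open_contains_ball by blast
  define U where "U = {z \<in> H. F z \<in> ball 0 d}"
  define h where "h = (\<lambda>z. F z /\<^sub>R d)"
  define k where "k = (\<lambda>w. G (d *\<^sub>R w))"
  have "open U"
    using continuous_open_preimage[OF contF H, of "ball 0 d"] by (simp add: U_def vimage_def Int_def)
  moreover have pU: "p \<in> U" using p F0 d by (simp add: U_def H_def)
  moreover have hom: "homeomorphism U (ball 0 1) h k"
  proof (rule homeomorphismI)
    show "continuous_on U h" unfolding h_def by (intro continuous_intros contF)
    have sc: "d *\<^sub>R w \<in> ball 0 d" if "w \<in> ball 0 1" for w :: complex
      using that d(1) by simp
    show "continuous_on (ball 0 1) k" unfolding k_def
      by (rule continuous_on_compose2[OF homeomorphism_cont2[OF G]])
        (use sc d in \<open>auto intro!: continuous_intros\<close>)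
    show "h ` U \<subseteq> ball 0 1"
      using d(1) by (auto simp: h_def U_def field_simps)
    have GH: "G v \<in> H" "F (G v) = v" if "v \<in> ball 0 d" for v
      using that d(2) homeomorphism_image2[OF G] homeomorphism_apply2[OF G] by blast+
    show "k ` ball 0 1 \<subseteq> U"
      using GH sc by (auto simp: k_def U_def)
    show "k (h z) = z" if "z \<in> U" for z
      using that d(1) homeomorphism_apply1[OF G] by (simp add: k_def h_def U_def)
    show "h (k w) = w" if "w \<in> ball 0 1" for w
      using GH(2)[OF sc[OF that]] d(1) by (simp add: k_def h_def)
  qed
  moreover have "h p = 0" by (simp add: h_def F0)
  moreover have "h ` (A \<inter> U) = {z \<in> ball 0 1. Im z = 0}"
  proof -
    have "z \<in> A \<longleftrightarrow> Im (h z) = 0" if "z \<in> U" for z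
      using that A[of z] d(1) rs by (auto simp: U_def H_def h_def F_def)
    then have "h ` (A \<inter> U) = {z \<in> h ` U. Im z = 0}" by blast
    then show ?thesis using homeomorphism_image1[OF hom] by simp
  qed
  moreover have "h ` (B \<inter> U) = {z \<in> ball 0 1. Re z = 0}"
  proof -
    have "z \<in> B \<longleftrightarrow> Re (h z) = 0" if "z \<in> U" for z
      using that B[of z] d(1) rs by (auto simp: U_def H_def h_def F_def)
    then have "h ` (B \<inter> U) = {z \<in> h ` U. Re z = 0}" by blast
    then show ?thesis using homeomorphism_image1[OF hom] by simp
  qed
  ultimately show ?thesis unfolding proper_crossing_def by blast
qed

section \<open>Circles with a diameter on the spine\<close>

definition diam_circle :: "complex \<Rightarrow> complex \<Rightarrow> complex set" where
  "diam_circle x y = sphere (midpoint x y) (dist x y / 2)"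

text \<open>Thales' theorem. With \<open>p = z - x\<close> and \<open>q = z - y\<close> it is the
  identity \<open>norm (p + q) ^ 2 - norm (p - q) ^ 2 = 4 * (p \<bullet> q)\<close>.\<close>

lemma mem_diam_circle_iff: "z \<in> diam_circle x y \<longleftrightarrow> (z - x) \<bullet> (z - y) = 0"
proof -
  have "z \<in> diam_circle x y \<longleftrightarrow> (2 * dist (midpoint x y) z)\<^sup>2 = (dist x y)\<^sup>2"
    unfolding diam_circle_def by (subst power2_eq_iff_nonneg) auto
  also have "2 * dist (midpoint x y) z = norm (x + y - 2 *\<^sub>R z)"
  proof -
    have "x + y - 2 *\<^sub>R z = 2 *\<^sub>R (midpoint x y - z)"
      by (simp add: midpoint_def algebra_simps)
    then show ?thesis by (simp add: dist_norm)
  qed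
  also have "(norm (x + y - 2 *\<^sub>R z))\<^sup>2 = (dist x y)\<^sup>2 \<longleftrightarrow> (z - x) \<bullet> (z - y) = 0"
    by (simp add: dist_norm power2_norm_eq_inner inner_simps inner_commute) (auto simp: algebra_simps)
  finally show ?thesis .
qed

text \<open>For \<open>z\<close> on the line, \<open>z - x\<close> and \<open>z - y\<close> are
  parallel; being orthogonal by Thales, one of them is zero.\<close>

lemma diam_circle_on_line:
  fixes n x y z :: complex
  assumes "n \<noteq> 0" "n \<bullet> x = c" "n \<bullet> y = c" "n \<bullet> z = c"
  shows "z \<in> diam_circle x y \<longleftrightarrow> z = x \<or> z = y"
proof
  assume "z \<in> diam_circle x y"
  then have 0: "(z - x) \<bullet> (z - y) = 0" by (simp add: mem_diam_circle_iff)
  have n: "n \<bullet> (z - x) = 0" "n \<bullet> (z - y) = 0" using assms by (simp_all add: inner_diff_right)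
  then have "((z - x) \<bullet> (z - x)) * ((z - y) \<bullet> (z - y)) = 0"
    by (simp add: inner_parallel[OF assms(1) n] 0)
  then show "z = x \<or> z = y" by simp
qed (auto simp: mem_diam_circle_iff)

lemma half_circle_eq: "half_circle n c x y = {z \<in> diam_circle x y. n \<bullet> z \<ge> c}"
  by (simp add: half_circle_def diam_circle_def)

lemma half_circle_commute: "half_circle n c x y = half_circle n c y x"
  by (simp add: half_circle_def midpoint_sym dist_commute)

text \<open>Concentric circles with a common point are equal, and a circle determines its diameter
  on the line as its trace there. This supplies the distinct centres required by the results on two
  circles.\<close>

lemma diam_circle_centres_differ:
  fixes n :: complex
  assumes n: "n \<noteq> 0" and line: "n \<bullet> u = c" "n \<bullet> v = c" "n \<bullet> x = c" "n \<bullet> y = c"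
    and ne: "{u, v} \<noteq> {x, y}"
    and p: "p \<in> diam_circle u v" "p \<in> diam_circle x y"
  shows "midpoint u v \<noteq> midpoint x y"
proof
  assume m: "midpoint u v = midpoint x y"
  then have "diam_circle u v = diam_circle x y"
    using p by (auto simp: diam_circle_def)
  then have "z = u \<or> z = v \<longleftrightarrow> z = x \<or> z = y" if "n \<bullet> z = c" for z
    using diam_circle_on_line[OF n line(1,2) that] diam_circle_on_line[OF n line(3,4) that] by simp
  then have "{u, v} = {x, y}"
    using line by (metis doubleton_eq_iff)
  with ne show False ..
qed

lemma inner_midpoint_line:
  fixes n :: complex
  assumes "n \<bullet> x = c" "n \<bullet> y = c"
  shows "n \<bullet> midpoint x y = c"
  using assms by (simp add: midpoint_def inner_add_right)

lemma diam_circle_half_circle_unique: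
  fixes n :: complex
  assumes n: "n \<noteq> 0" and line: "n \<bullet> u = c" "n \<bullet> v = c" "n \<bullet> x = c" "n \<bullet> y = c"
    and ne: "{u, v} \<noteq> {x, y}"
    and p: "p \<in> diam_circle u v \<inter> half_circle n c x y"
    and q: "q \<in> diam_circle u v \<inter> half_circle n c x y"
  shows "p = q"
proof (rule equidistant_half_plane_unique[OF n])
  show "midpoint u v \<noteq> midpoint x y"
    using diam_circle_centres_differ[OF n line ne] p by (auto simp: half_circle_eq)
qed (use p q line in \<open>auto simp: half_circle_eq diam_circle_def dist_commute inner_midpoint_line\<close>)

text \<open>The set \<open>A\<close> is prescribed only strictly above the line, so it can be the
  whole circle as well as its half on the same page. Common points on the line are end-points of
  both diameters; all others are covered by \<open>proper_crossing_circles\<close>.\<close>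

lemma diam_circle_half_circle_crossing:
  fixes n :: complex
  assumes n: "n \<noteq> 0" and line: "n \<bullet> u = c" "n \<bullet> v = c" "n \<bullet> x = c" "n \<bullet> y = c"
    and ne: "{u, v} \<noteq> {x, y}"
    and p: "p \<in> diam_circle u v" "p \<in> half_circle n c x y"
    and A: "\<And>z. n \<bullet> z > c \<Longrightarrow> z \<in> A \<longleftrightarrow> z \<in> diam_circle u v"
  shows "p \<in> {u, v} \<inter> {x, y} \<or> proper_crossing p A (half_circle n c x y)"
proof (cases "n \<bullet> p = c")
  case True
  then show ?thesis
    using p diam_circle_on_line[OF n line(1,2) True] diam_circle_on_line[OF n line(3,4) True]
    by (simp add: half_circle_eq)
next
  case False
  have "proper_crossing p A (half_circle n c x y)"
  proof (rule proper_crossing_circles[OF n])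
    show "midpoint u v \<noteq> midpoint x y"
      using diam_circle_centres_differ[OF n line ne] p by (auto simp: half_circle_eq)
    show "p \<in> sphere (midpoint u v) (dist u v / 2)" "p \<in> sphere (midpoint x y) (dist x y / 2)"
      using p by (simp_all add: half_circle_eq diam_circle_def)
    show "n \<bullet> p > c" using p False by (simp add: half_circle_eq)
  qed (use A line in \<open>auto simp: half_circle_def diam_circle_def inner_midpoint_line\<close>)
  then show ?thesis ..
qed

section \<open>Half-circles as arcs\<close>

lemma upper_unit_circle: "{w. norm w = 1 \<and> Im w \<ge> 0} = (\<lambda>t. cis (pi * t)) ` {0..1}"
proof (intro equalityI subsetI)
  fix w assume w: "w \<in> {w. norm w = 1 \<and> Im w \<ge> 0}"
  then have "w \<noteq> 0" by auto
  with w have "w = cis (Arg w)" by (simp add: cis_Arg sgn_eq)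
  moreover have "0 \<le> Arg w" "Arg w \<le> pi"
    using w Arg_le_pi by (simp_all add: Arg_less_0)
  ultimately show "w \<in> (\<lambda>t. cis (pi * t)) ` {0..1}"
    by (intro image_eqI[where x = "Arg w / pi"]) auto
next
  fix w assume "w \<in> (\<lambda>t. cis (pi * t)) ` {0..1}"
  then obtain t where t: "0 \<le> t" "t \<le> 1" "w = cis (pi * t)" by auto
  have "sin (pi * t) \<ge> 0"
    using t by (intro sin_ge_zero) (auto intro: mult_left_le)
  then show "w \<in> {w. norm w = 1 \<and> Im w \<ge> 0}" using t by simp
qed

text \<open>A similarity \<open>w \<mapsto> m + a * w\<close>, with \<open>m\<close> the midpoint
  and \<open>a\<close> a radius vector along the line, carries the upper unit half-circle onto the
  given one.\<close>

lemma half_circle_arc: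
  fixes n x y :: complex
  assumes n: "n \<noteq> 0" and line: "n \<bullet> x = c" "n \<bullet> y = c" and xy: "x \<noteq> y"
  shows "\<exists>g. arc g \<and> path_image g = half_circle n c x y \<and> {pathstart g, pathfinish g} = {x, y}"
proof -
  text \<open>The normal is \<open>k * \<i> * (x - y)\<close>; the sign of \<open>k\<close> decides which end-point the
    counterclockwise arc starts from.\<close>
  have main: "\<exists>g. arc g \<and> path_image g = half_circle n c x y \<and> {pathstart g, pathfinish g} = {x, y}"
    if line: "n \<bullet> x = c" "n \<bullet> y = c" and xy: "x \<noteq> y"
    and k: "n = of_real k * \<i> * (x - y)" "k > 0" for x y k
  proof -
    define m where "m = midpoint x y"
    define a where "a = x - m"
    have "2 * m = x + y" by (simp add: m_def midpoint_def scaleR_conv_of_real)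
    then have a2: "x - y = 2 * a" and ya: "y = m - a"
      by (simp_all add: a_def algebra_simps)
    have a0: "a \<noteq> 0" using xy a2 by auto
    have nm: "n \<bullet> m = c" unfolding m_def by (rule inner_midpoint_line[OF line])
    have norma: "dist x y / 2 = norm a" by (simp add: dist_norm a2 norm_mult)
    \<comment> \<open>The height over the line is a positive multiple of \<open>Im w\<close>, so the
      side chosen by \<open>n\<close> corresponds to the upper half-plane.\<close>
    have inner: "n \<bullet> (a * w) = 2 * k * (norm a)\<^sup>2 * Im w" for w
      unfolding k a2 cmod_power2 by (simp add: inner_complex_def power2_eq_square algebra_simps)
    define g where "g = (\<lambda>t. m + a * cis (pi * t))"
    have mem: "m + a * w \<in> half_circle n c x y \<longleftrightarrow> norm w = 1 \<and> Im w \<ge> 0" for w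
    proof -
      have "m + a * w \<in> sphere m (norm a) \<longleftrightarrow> norm w = 1"
        using a0 by (simp add: dist_norm norm_mult)
      moreover have "n \<bullet> (m + a * w) \<ge> c \<longleftrightarrow> Im w \<ge> 0"
        using mult_le_cancel_left_pos[of "2 * k * (norm a)\<^sup>2" 0 "Im w"] a0 k(2)
        by (simp add: inner_add_right nm inner)
      ultimately show ?thesis by (simp add: half_circle_def norma m_def)
    qed
    have "half_circle n c x y = (\<lambda>w. m + a * w) ` {w. norm w = 1 \<and> Im w \<ge> 0}"
    proof (intro equalityI subsetI)
      fix z assume z: "z \<in> half_circle n c x y"
      have "z = m + a * ((z - m) / a)" using a0 by simp
      then show "z \<in> (\<lambda>w. m + a * w) ` {w. norm w = 1 \<and> Im w \<ge> 0}"
        using z mem[of "(z - m) / a"] by (metis (mono_tags, lifting) image_eqI mem_Collect_eq)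
    qed (use mem in auto)
    then have "path_image g = half_circle n c x y"
      by (simp add: upper_unit_circle path_image_def g_def image_image)
    moreover have "arc g"
      unfolding arc_def path_def
    proof
      show "continuous_on {0..1} g" unfolding g_def by (intro continuous_intros)
      show "inj_on g {0..1}"
      proof (rule inj_onI)
        fix s t :: real assume st: "s \<in> {0..1}" "t \<in> {0..1}" "g s = g t"
        then have "cis (pi * s) = cis (pi * t)" using a0 by (simp add: g_def)
        \<comment> \<open>The angles lie in the interval from 0 to pi, where the cosine alone is
          injective.\<close>
        then have "Re (cis (pi * s)) = Re (cis (pi * t))" by (rule arg_cong)
        then have "cos (pi * s) = cos (pi * t)" by simp
        moreover have "0 \<le> pi * r" "pi * r \<le> pi" if "r \<in> {0..1}" for r
          using that by (simp_all add: mult_left_le)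
        ultimately have "pi * s = pi * t"
          using st(1,2) by (meson cos_inj_pi)
        then show "s = t" by simp
      qed
    qed
    moreover have "{pathstart g, pathfinish g} = {x, y}"
      by (simp add: pathstart_def pathfinish_def g_def ya) (simp add: a_def)
    ultimately show ?thesis by (intro exI[of _ g] conjI)
  qed
  \<comment> \<open>As \<open>n\<close> is orthogonal to \<open>x - y\<close>, the quotient is
    purely imaginary and \<open>k\<close> captures it completely. Exchanging \<open>x\<close> and
    \<open>y\<close> flips the sign of \<open>k\<close>.\<close>
  define k where "k = Im (n / (x - y))"
  have perp: "n \<bullet> (x - y) = 0" using line by (simp add: inner_diff_right)
  then have "Re (n / (x - y)) = 0"
    by (simp add: Re_divide inner_complex_def)
  then have "n / (x - y) = of_real k * \<i>" by (simp add: k_def complex_eq_iff)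
  then have k: "n = of_real k * \<i> * (x - y)" using xy by (simp add: field_simps)
  show ?thesis
  proof (cases "k > 0")
    case True
    then show ?thesis by (rule main[OF line xy k])
  next
    case False
    moreover have "k \<noteq> 0" using k n by (metis mult_zero_left of_real_0)
    ultimately have k': "- k > 0" by simp
    have "n = of_real (- k) * \<i> * (y - x)" unfolding k by (simp add: algebra_simps)
    from main[OF line(2,1) xy[symmetric] this k'] show ?thesis
      by (subst half_circle_commute, subst insert_commute)
  qed
qed

lemma diam_circle_simple_loop:
  assumes "x \<noteq> y"
  obtains \<gamma> where "simple_path \<gamma>" "pathfinish \<gamma> = pathstart \<gamma>" "path_image \<gamma> = diam_circle x y"
  by (rule that[of "circlepath (midpoint x y) (dist x y / 2)"])
    (use assms in \<open>auto simp: diam_circle_def simple_path_circlepath\<close>)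

section \<open>Separability of the book drawing\<close>

theorem mainTheorem5:
  fixes V :: "'a set" and E :: "'a set set"
    and pos :: "'a \<Rightarrow> complex" and crv :: "'a set \<Rightarrow> complex set"
  assumes "two_page_book_drawing V E pos crv"
  shows "separable_drawing V E pos crv"
proof -
  obtain n c where sg: "simple_graph V E" and inj: "inj_on pos V" and n0: "n \<noteq> 0"
    and line: "\<And>v. v \<in> V \<Longrightarrow> n \<bullet> pos v = c"
    and hc: "\<And>u v. {u, v} \<in> E \<Longrightarrow> crv {u, v} = half_circle n c (pos u) (pos v) \<or>
          crv {u, v} = half_circle (- n) (- c) (pos u) (pos v)"
    using assms unfolding two_page_book_drawing_def by blast
  \<comment> \<open>The two pages are the two orientations of the same spine; quantifying over them
    treats both sides uniformly.\<close>
  define page where "page = (\<lambda>n' c'. n' = n \<and> c' = c \<or> n' = - n \<and> c' = - c)"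
  have page: "n' \<noteq> 0" "v \<in> V \<Longrightarrow> n' \<bullet> pos v = c'" if "page n' c'" for n' c' v
    using that n0 line by (auto simp: page_def)
  have edge: "\<exists>u v n' c'. e = {u, v} \<and> u \<in> V \<and> v \<in> V \<and> pos u \<noteq> pos v \<and> page n' c' \<and>
      crv e = half_circle n' c' (pos u) (pos v)" if e: "e \<in> E" for e
  proof -
    obtain u v where uv: "e = {u, v}" "u \<noteq> v" "u \<in> V" "v \<in> V"
      using sg e unfolding simple_graph_def by (metis card_2_iff insert_subset)
    moreover have "pos u \<noteq> pos v" using uv inj by (auto dest: inj_onD)
    moreover have "\<exists>n' c'. page n' c' \<and> crv e = half_circle n' c' (pos u) (pos v)"
      using hc[of u v] e unfolding page_def uv(1) by blast
    ultimately show ?thesis by blast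
  qed
  have sub: "e \<subseteq> V" if "e \<in> E" for e using sg that by (auto simp: simple_graph_def)
  have pos_ne: "pos ` e \<noteq> pos ` f" if "e \<in> E" "f \<in> E" "e \<noteq> f" for e f
    using inj_on_image_eq_iff[OF inj sub sub] that by simp
  have crv_V: "crv e \<inter> pos ` V = pos ` e"
    and arc: "\<exists>g. arc g \<and> path_image g = crv e \<and> {pathstart g, pathfinish g} = pos ` e"
    if "e \<in> E" for e
  proof -
    obtain u v n' c' where uv: "e = {u, v}" "u \<in> V" "v \<in> V" "pos u \<noteq> pos v" and pg: "page n' c'"
      and crv: "crv e = half_circle n' c' (pos u) (pos v)" using edge[OF \<open>e \<in> E\<close>] by blast
    show "crv e \<inter> pos ` V = pos ` e"
      using diam_circle_on_line[OF page(1)[OF pg] page(2)[OF pg uv(2)] page(2)[OF pg uv(3)]] page(2)[OF pg] uv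
      unfolding crv half_circle_eq by auto
    show "\<exists>g. arc g \<and> path_image g = crv e \<and> {pathstart g, pathfinish g} = pos ` e"
      using half_circle_arc[OF page(1)[OF pg] page(2)[OF pg uv(2)] page(2)[OF pg uv(3)] uv(4)]
      unfolding crv by (simp add: uv(1))
  qed
  \<comment> \<open>The first two clauses, with \<open>S\<close> the circle through
    \<open>e\<close>, serve the separator property. The third gives the crossings of the edges
    themselves; their uniqueness is inherited from the circle.\<close>
  define meets_once where "meets_once e S f \<longleftrightarrow>
        (\<forall>p \<in> S \<inter> crv f. \<forall>q \<in> S \<inter> crv f. p = q) \<and>
        (\<forall>p \<in> S \<inter> crv f. p \<in> pos ` e \<inter> pos ` f \<or> proper_crossing p S (crv f)) \<and>
        (\<forall>p \<in> crv e \<inter> crv f. p \<in> pos ` e \<inter> pos ` f \<or> proper_crossing p (crv e) (crv f))"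
    for e S f
  have circle: thesis if e: "e \<in> E" and S: "\<And>S. crv e \<subseteq> S \<Longrightarrow> S \<inter> pos ` V = pos ` e \<Longrightarrow>
      \<exists>\<gamma>. simple_path \<gamma> \<and> pathfinish \<gamma> = pathstart \<gamma> \<and> path_image \<gamma> = S \<Longrightarrow>
      (\<And>f. f \<in> E \<Longrightarrow> f \<noteq> e \<Longrightarrow> meets_once e S f) \<Longrightarrow> thesis" for e thesis
  proof -
    obtain u v n' c' where uv: "e = {u, v}" "u \<in> V" "v \<in> V" "pos u \<noteq> pos v" and pg: "page n' c'"
      and crve: "crv e = half_circle n' c' (pos u) (pos v)" using edge[OF e] by blast
    define S where "S = diam_circle (pos u) (pos v)"
    have "crv e \<subseteq> S" by (auto simp: crve S_def half_circle_eq)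
    moreover have "S \<inter> pos ` V = pos ` e"
      using diam_circle_on_line[OF n0 line line line] uv unfolding S_def by auto
    moreover have "\<exists>\<gamma>. simple_path \<gamma> \<and> pathfinish \<gamma> = pathstart \<gamma> \<and> path_image \<gamma> = S"
      using diam_circle_simple_loop[OF uv(4)] unfolding S_def by metis
    moreover have "meets_once e S f"
      if f: "f \<in> E" "f \<noteq> e" for f
    proof -
      obtain x y n'' c'' where xy: "f = {x, y}" "x \<in> V" "y \<in> V" and pg': "page n'' c''"
        and crvf: "crv f = half_circle n'' c'' (pos x) (pos y)" using edge[OF f(1)] by blast
      have ne: "{pos u, pos v} \<noteq> {pos x, pos y}"
        using pos_ne[OF e f(1)] f(2) uv(1) xy(1) by auto
      note l = page(1)[OF pg'] page(2)[OF pg' uv(2)] page(2)[OF pg' uv(3)]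
        page(2)[OF pg' xy(2)] page(2)[OF pg' xy(3)]
      have "p = q" if "p \<in> S \<inter> crv f" "q \<in> S \<inter> crv f" for p q
        using diam_circle_half_circle_unique[OF l ne] that by (simp add: S_def crvf)
      \<comment> \<open>Needed for \<open>A\<close> the whole circle and, below, for
        \<open>A\<close> the half-circle \<open>crv e\<close>.\<close>
      moreover have cr: "p \<in> pos ` e \<inter> pos ` f \<or> proper_crossing p A (crv f)"
        if "p \<in> S \<inter> crv f" "\<And>z. n'' \<bullet> z > c'' \<Longrightarrow> z \<in> A \<longleftrightarrow> z \<in> S" for p A
        using diam_circle_half_circle_crossing[OF l ne, of p A] that
        unfolding crvf by (simp add: S_def uv(1) xy(1))
      moreover have "p \<in> pos ` e \<inter> pos ` f \<or> proper_crossing p (crv e) (crv f)"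
        if p: "p \<in> crv e \<inter> crv f" for p
      proof (cases "n' = n''")
        case True
        \<comment> \<open>Equal normals mean the same page because \<open>n\<close> differs from
          \<open>- n\<close>. Off the spine, \<open>crv e\<close> then agrees with \<open>S\<close>
          on this page.\<close>
        then have "c' = c''" using pg pg' n0 by (auto simp: page_def)
        then show ?thesis
          using p True by (intro cr) (auto simp: crve half_circle_eq S_def)
      next
        case False
        then have "n'' = - n'" "c'' = - c'" using pg pg' by (auto simp: page_def)
        \<comment> \<open>Half-circles on opposite pages can meet only on the spine, where each
          contains just its end-points.\<close>
        then have p0: "n'' \<bullet> p = c''" using p by (auto simp: crve crvf half_circle_eq)
        show ?thesis
          using p diam_circle_on_line[OF l(1,2,3) p0] diam_circle_on_line[OF l(1,4,5) p0]
          unfolding crve crvf by (simp add: half_circle_eq uv(1) xy(1))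
      qed
      ultimately show ?thesis by (simp add: meets_once_def)
    qed
    ultimately show thesis by (rule S)
  qed
  have int: "pos ` e \<inter> pos ` f = pos ` (e \<inter> f)" if "e \<in> E" "f \<in> E" for e f
    using inj_on_image_Int[OF inj sub sub] that by simp
  have "simple_drawing V E pos crv"
    unfolding simple_drawing_def
  proof (intro conjI ballI impI sg inj)
    fix e f p q assume ef: "e \<in> E" "f \<in> E" "e \<noteq> f" and p: "p \<in> crv e \<inter> crv f"
    obtain S where S: "crv e \<subseteq> S" "meets_once e S f"
      by (rule circle[OF ef(1)]) (use ef(2,3) in auto)
    \<comment> \<open>Two common points of the edges are also common points of the circle
      \<open>S\<close> and \<open>crv f\<close>.\<close>
    show "p = q" if "q \<in> crv e \<inter> crv f" using S p that unfolding meets_once_def by blast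
    show "p \<in> pos ` (e \<inter> f) \<or> proper_crossing p (crv e) (crv f)"
      using S(2) p int[OF ef(1,2)] by (simp add: meets_once_def)
  qed (use crv_V arc in auto)
  moreover have "separator_edge V E pos crv e" if "e \<in> E" for e
  proof -
    obtain S where S: "crv e \<subseteq> S" "S \<inter> pos ` V = pos ` e"
        "\<exists>\<gamma>. simple_path \<gamma> \<and> pathfinish \<gamma> = pathstart \<gamma> \<and> path_image \<gamma> = S"
        "\<And>f. f \<in> E \<Longrightarrow> f \<noteq> e \<Longrightarrow> meets_once e S f"
      by (rule circle[OF \<open>e \<in> E\<close>]) (rule that)
    obtain \<gamma> where \<gamma>: "simple_path \<gamma>" "pathfinish \<gamma> = pathstart \<gamma>" "path_image \<gamma> = S"
      using S(3) by blast
    show ?thesis unfolding separator_edge_def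
    proof (intro exI[of _ \<gamma>] conjI ballI impI; (unfold \<gamma>(3))?)
      fix f p q assume f: "f \<in> E" "f \<noteq> e" and p: "p \<in> S \<inter> crv f"
      show "p = q" if "q \<in> S \<inter> crv f" using S(4)[OF f] p that unfolding meets_once_def by blast
      show "proper_crossing p S (crv f) \<or> p \<in> pos ` f"
        using S(4)[OF f] p unfolding meets_once_def by blast
    qed (use S \<gamma> in auto)
  qed
  ultimately show ?thesis unfolding separable_drawing_def by blast
qed

end
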